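(* Let $n\ge1$ and let $Q_n$ be the graph whose vertices are the unit squares of $AD(n)$ lying in the quadrant $x\le0$, $y\ge0$, two squares adjacent iff they share an edge. Its distinguished vertices are the $2n-1$ squares $[-1,0]\times[j,j+1]$ ($0\le j\le n-1$) and $[i,i+1]\times[0,1]$ ($-n\le i\le -1$); the square $c=[-1,0]\times[0,1]$ is called the middle distinguished vertex. For a set $S$ of distinguished vertices let $M(Q_n-S)$ be the number of perfect matchings of $Q_n$ with $S$ deleted, and let $w(S)=2$ if $c\in S$ and $w(S)=1$ otherwise. Then \[\sum_{S}w(S)\,M(Q_n-S),\] the sum over all subsets $S$ of the distinguished vertices, equals the number of domino tilings of $AD(n)$ invariant under both $t$ and $r^2$.
   Context: $AD(n)$ is the union of all unit lattice squares $[i,i+1]\times[j,j+1]$ ($i,j\in\mathbb{Z}$) contained in $|x|+|y|\le n+1$; domino tilings cover it by $1\times2$ or $2\times1$ dominoes without gaps or overlaps. $t$ is the reflection across the line $x=0$ and $r^2$ is rotation by $180^\circ$ about the origin. *)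

theory Defs
  imports "HOL-Analysis.Analysis"
begin

definition unit_square :: "int \<Rightarrow> int \<Rightarrow> (real \<times> real) set" where
  "unit_square i j = {of_int i .. of_int i + 1} \<times> {of_int j .. of_int j + 1}"

definition AD_squares :: "nat \<Rightarrow> (real \<times> real) set set" where
  "AD_squares n = {unit_square i j | i j.
     unit_square i j \<subseteq> {(x, y). \<bar>x\<bar> + \<bar>y\<bar> \<le> real n + 1}}"

definition AD :: "nat \<Rightarrow> (real \<times> real) set" where
  "AD n = \<Union> (AD_squares n)"

text \<open>Dominoes have their corners at lattice points.\<close>

definition domino :: "(real \<times> real) set \<Rightarrow> bool" where
  "domino D \<longleftrightarrow> (\<exists>i j :: int.
     D = {of_int i .. of_int i + 2} \<times> {of_int j .. of_int j + 1} \<or>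
     D = {of_int i .. of_int i + 1} \<times> {of_int j .. of_int j + 2})"

definition domino_tiling :: "(real \<times> real) set \<Rightarrow> (real \<times> real) set set \<Rightarrow> bool" where
  "domino_tiling R T \<longleftrightarrow>
     (\<forall>D\<in>T. domino D) \<and> \<Union> T = R \<and>
     pairwise (\<lambda>D D'. interior D \<inter> interior D' = {}) T"

definition refl_t :: "real \<times> real \<Rightarrow> real \<times> real" where
  "refl_t = (\<lambda>(x, y). (- x, y))"

definition rot180 :: "real \<times> real \<Rightarrow> real \<times> real" where
  "rot180 = (\<lambda>(x, y). (- x, - y))"

definition invariant_under :: "('a \<Rightarrow> 'a) \<Rightarrow> 'a set set \<Rightarrow> bool" where
  "invariant_under f T \<longleftrightarrow> (\<lambda>D. f ` D) ` T = T"

text \<open>A graph is a pair of a vertex set and a set of edges, each edge being a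
  two-element set of vertices.\<close>

type_synonym 'a ugraph = "'a set \<times> 'a set set"

definition delete_vertices :: "'a ugraph \<Rightarrow> 'a set \<Rightarrow> 'a ugraph" where
  "delete_vertices G S = (fst G - S, {e \<in> snd G. e \<inter> S = {}})"

definition perfect_matching :: "'a ugraph \<Rightarrow> 'a set set \<Rightarrow> bool" where
  "perfect_matching G M \<longleftrightarrow> M \<subseteq> snd G \<and> (\<forall>v\<in>fst G. \<exists>!e. e \<in> M \<and> v \<in> e)"

definition num_perfect_matchings :: "'a ugraph \<Rightarrow> nat" where
  "num_perfect_matchings G = card {M. perfect_matching G M}"

text \<open>For unit lattice squares, the intersection is a unit lattice segment exactly
  when the squares are distinct and have a common side.\<close>

definition share_edge :: "(real \<times> real) set \<Rightarrow> (real \<times> real) set \<Rightarrow> bool" where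
  "share_edge A B \<longleftrightarrow> (\<exists>i j :: int.
     A \<inter> B = {of_int i} \<times> {of_int j .. of_int j + 1} \<or>
     A \<inter> B = {of_int i .. of_int i + 1} \<times> {of_int j})"

definition Q_vertices :: "nat \<Rightarrow> (real \<times> real) set set" where
  "Q_vertices n = {A \<in> AD_squares n. A \<subseteq> {(x, y). x \<le> 0 \<and> y \<ge> 0}}"

definition Q :: "nat \<Rightarrow> (real \<times> real) set ugraph" where
  "Q n = (Q_vertices n,
     {{A, B} | A B. A \<in> Q_vertices n \<and> B \<in> Q_vertices n \<and> share_edge A B})"

definition distinguished :: "nat \<Rightarrow> (real \<times> real) set set" where
  "distinguished n =
     {unit_square (- 1) j | j. 0 \<le> j \<and> j \<le> int n - 1} \<union>
     {unit_square i 0 | i. - int n \<le> i \<and> i \<le> - 1}"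

definition middle :: "(real \<times> real) set" where
  "middle = unit_square (- 1) 0"

definition weight :: "(real \<times> real) set set \<Rightarrow> nat" where
  "weight S = (if middle \<in> S then 2 else 1)"

end

theory Submission
  imports Defs
begin

text \<open>
  A tiling invariant under both symmetries is invariant under the Klein group generated by the
  reflections in the axes, for which the quadrant is a fundamental domain. Dominoes meeting the
  interior of the quadrant either lie in it or are bisected by an axis, and a bisected domino
  is determined by its distinguished square, except that the middle square may lie in a domino
  bisected by either axis. So the tiling is the same thing as a set of distinguished squares
  covered by bisected dominoes, a perfect matching of the remaining squares of the quadrant, and
  a binary choice if the middle square was removed.
\<close>

section \<open>Symmetric matchings of lattice cells\<close>

text \<open>\<open>refl_t\<close> composed with \<open>rot180\<close> is the reflection in y = 0,
  hence the Klein group. Both axes are lattice lines, so a domino with cells on both sides of an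
  axis consists of a cell and its mirror image, and no domino crosses both axes. The geometric
  obstacle is that tiles are closed real rectangles, which may share boundary points. The counting
  is therefore done on integer cells, (i, j) standing for [i, i+1] x [j, j+1], and tilings are
  translated by means of cell centres, each of which lies in exactly one cell. In a triple (S, N, b)
  the set S is already determined by N, as the cells of the quadrant that N leaves uncovered; it is
  kept because the sum runs over it. The only additional information is b, which is pinned to
  \<open>False\<close> when the middle cell is not in S, so that each matching has exactly one
  triple.\<close>

definition adjacent :: "int \<times> int \<Rightarrow> int \<times> int \<Rightarrow> bool" where
  "adjacent p q \<longleftrightarrow> \<bar>fst p - fst q\<bar> + \<bar>snd p - snd q\<bar> = 1"

definition cell_graph :: "(int \<times> int) set \<Rightarrow> (int \<times> int) ugraph" where
  "cell_graph C = (C, {{p, q} | p q. p \<in> C \<and> q \<in> C \<and> adjacent p q})"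

text \<open>A cell is named by its lower left corner, and reflection sends [i, i+1] to [-1-i, -i];
  hence the offset -1.\<close>

definition mirror_x :: "int \<times> int \<Rightarrow> int \<times> int" where
  "mirror_x p = (- 1 - fst p, snd p)"

definition mirror_y :: "int \<times> int \<Rightarrow> int \<times> int" where
  "mirror_y p = (fst p, - 1 - snd p)"

definition klein :: "(int \<times> int \<Rightarrow> int \<times> int) set" where
  "klein = {id, mirror_x, mirror_y, mirror_x \<circ> mirror_y}"

text \<open>Since all elements of \<open>klein\<close> are involutions, this is the union of the
  images of \<open>K\<close> under the group. The preimage form reduces membership to moving one
  edge into \<open>K\<close>.\<close>

definition klein_closure :: "(int \<times> int) set set \<Rightarrow> (int \<times> int) set set" where
  "klein_closure K = {e. \<exists>g\<in>klein. g ` e \<in> K}"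

text \<open>The cell \<open>(- 1, 0)\<close> touches both axes; \<open>b\<close> selects whether its edge crosses \<open>x = 0\<close>
  (if true) or \<open>y = 0\<close>.\<close>

definition crossing_edge :: "bool \<Rightarrow> int \<times> int \<Rightarrow> (int \<times> int) set" where
  "crossing_edge b p =
     (if fst p = - 1 \<and> (snd p \<noteq> 0 \<or> b) then {p, mirror_x p} else {p, mirror_y p})"

lemma perfect_matching_cell_graph:
  "perfect_matching (cell_graph C) M \<longleftrightarrow>
     (\<forall>e\<in>M. \<exists>p\<in>C. \<exists>q\<in>C. e = {p, q} \<and> adjacent p q) \<and> (\<forall>p\<in>C. \<exists>!e. e \<in> M \<and> p \<in> e)"
proof -
  have "M \<subseteq> snd (cell_graph C) \<longleftrightarrow> (\<forall>e\<in>M. \<exists>p\<in>C. \<exists>q\<in>C. e = {p, q} \<and> adjacent p q)"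
    unfolding cell_graph_def snd_conv subset_eq mem_Collect_eq by blast
  then show ?thesis by (simp add: perfect_matching_def cell_graph_def)
qed

lemma matching_edge:
  "perfect_matching (cell_graph C) M \<Longrightarrow> e \<in> M \<Longrightarrow> \<exists>p\<in>C. \<exists>q\<in>C. e = {p, q} \<and> adjacent p q"
  by (simp add: perfect_matching_cell_graph)

lemma matching_covers: "perfect_matching (cell_graph C) M \<Longrightarrow> p \<in> C \<Longrightarrow> \<exists>e\<in>M. p \<in> e"
  unfolding perfect_matching_cell_graph by blast

lemma matching_unique:
  "perfect_matching (cell_graph C) M \<Longrightarrow> p \<in> C \<Longrightarrow> e \<in> M \<Longrightarrow> e' \<in> M \<Longrightarrow> p \<in> e \<Longrightarrow> p \<in> e' \<Longrightarrow> e = e'"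
  unfolding perfect_matching_cell_graph by blast

lemma delete_vertices_cell_graph: "delete_vertices (cell_graph C) S = cell_graph (C - S)"
proof -
  have "e \<in> snd (cell_graph C) \<and> e \<inter> S = {} \<longleftrightarrow> e \<in> snd (cell_graph (C - S))" for e
  proof -
    have "{p, q} \<inter> S = {} \<longleftrightarrow> p \<notin> S \<and> q \<notin> S" for p q by simp
    then show ?thesis
      unfolding cell_graph_def snd_conv mem_Collect_eq Diff_iff by metis
  qed
  then have "{e \<in> snd (cell_graph C). e \<inter> S = {}} = snd (cell_graph (C - S))" by blast
  then show ?thesis by (simp add: delete_vertices_def cell_graph_def)
qed

lemma perfect_matching_delete_cells:
  "perfect_matching (delete_vertices (cell_graph C) S) M \<longleftrightarrow>
     (\<forall>e\<in>M. \<exists>p\<in>C - S. \<exists>q\<in>C - S. e = {p, q} \<and> adjacent p q) \<and>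
     (\<forall>p\<in>C - S. \<exists>!e. e \<in> M \<and> p \<in> e)"
  unfolding delete_vertices_cell_graph perfect_matching_cell_graph ..

section \<open>The Klein group and its fundamental domain\<close>

lemma mirror_x_mirror_x [simp]: "mirror_x (mirror_x p) = p" and mirror_y_mirror_y [simp]: "mirror_y (mirror_y p) = p"
  by (simp_all add: mirror_x_def mirror_y_def)

lemma mirror_x_mirror_y: "mirror_x (mirror_y p) = mirror_y (mirror_x p)"
  by (simp add: mirror_x_def mirror_y_def)

lemma klein_involution: "g \<in> klein \<Longrightarrow> g (g p) = p"
  by (auto simp: klein_def mirror_x_mirror_y)

lemma klein_image_involution: "g \<in> klein \<Longrightarrow> g ` g ` e = e"
  by (simp add: image_image klein_involution)

lemma klein_mirror_x: "g \<in> klein \<Longrightarrow> g \<circ> mirror_x \<in> klein"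
  and klein_mirror_y: "g \<in> klein \<Longrightarrow> g \<circ> mirror_y \<in> klein"
  unfolding klein_def comp_def id_def by (auto simp: mirror_x_mirror_y)

lemma klein_adjacent: "g \<in> klein \<Longrightarrow> adjacent (g p) (g q) \<longleftrightarrow> adjacent p q"
  by (auto simp: klein_def adjacent_def mirror_x_def mirror_y_def)

lemma klein_to_quadrant: "\<exists>g\<in>klein. fst (g p) < 0 \<and> 0 \<le> snd (g p)"
  by (cases "fst p < 0"; cases "0 \<le> snd p") (auto simp: klein_def mirror_x_def mirror_y_def)

text \<open>Uniqueness half of the fundamental domain property: -1-i < 0 holds iff 0 \<le> i, so
  each mirror flips one of the two sign conditions, and only \<open>id\<close> flips
  neither.\<close>

lemma klein_free_on_quadrant:
  assumes "g \<in> klein" "fst p < 0" "0 \<le> snd p" "fst (g p) < 0" "0 \<le> snd (g p)"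
  shows "g = id"
  using assms by (auto simp: klein_def mirror_x_def mirror_y_def)

text \<open>The mirror swapping the two cells of a crossing edge fixes the edge as a set. Hence
  \<open>g\<close> is the identity or that mirror, and pulling back along \<open>g\<close> gives the
  same edge again.\<close>

lemma klein_crossing_edge:
  assumes "g \<in> klein" "g ` e = crossing_edge b s" "p \<in> e"
    and "fst p < 0" "0 \<le> snd p" "fst s < 0" "0 \<le> snd s"
  shows "p = s \<and> e = crossing_edge b s"
proof -
  obtain m where m: "m = mirror_x \<or> m = mirror_y" "crossing_edge b s = {s, m s}"
    unfolding crossing_edge_def by metis
  have e: "e = {g s, g (m s)}"
    using klein_image_involution[OF assms(1), of e] assms(2) m(2) by simp
  with assms(3) consider "p = g s" | "p = g (m s)" by blast
  then show ?thesis
  proof cases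
    case 1
    then have "g = id" using klein_free_on_quadrant[OF assms(1), of s] assms(4-7) by simp
    then show ?thesis using 1 e m(2) by simp
  next
    case 2
    \<comment> \<open>\<open>g\<close> composed with \<open>m\<close> keeps \<open>s\<close> in the
      quadrant, so freeness makes it the identity.\<close>
    have "g \<circ> m \<in> klein" using m(1) klein_mirror_x klein_mirror_y assms(1) by blast
    then have id: "g \<circ> m = id" using klein_free_on_quadrant[of "g \<circ> m" s] assms(4-7) 2 by simp
    have "g s = (g \<circ> m) (m s)" using m(1) by auto
    then have "g s = m s" "g (m s) = s" using id by (metis comp_apply id_apply)+
    then show ?thesis using 2 e m(2) by (simp add: insert_commute)
  qed
qed

section \<open>From a symmetric matching to its quarter data\<close>

locale symmetric_region =
  fixes C :: "(int \<times> int) set"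
  assumes finite_region: "finite C"
    and mirror_x_region: "p \<in> C \<Longrightarrow> mirror_x p \<in> C"
    and mirror_y_region: "p \<in> C \<Longrightarrow> mirror_y p \<in> C"
begin

definition quadrant :: "(int \<times> int) set" where
  "quadrant = {p \<in> C. fst p < 0 \<and> 0 \<le> snd p}"

definition axis_cells :: "(int \<times> int) set" where
  "axis_cells = {p \<in> quadrant. fst p = - 1 \<or> snd p = 0}"

definition symmetric_matchings :: "(int \<times> int) set set set" where
  "symmetric_matchings = {M. perfect_matching (cell_graph C) M \<and>
     (`) mirror_x ` M = M \<and> (`) mirror_y ` M = M}"

definition inner_edges :: "(int \<times> int) set set \<Rightarrow> (int \<times> int) set set" where
  "inner_edges M = {e \<in> M. e \<subseteq> quadrant}"

text \<open>The last factor has two elements or one, which is where the weight comes from;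
  \<open>False\<close> is the default when there is no choice to record.\<close>

definition quarter_data :: "((int \<times> int) set \<times> (int \<times> int) set set \<times> bool) set" where
  "quarter_data = (SIGMA S : Pow axis_cells.
     {N. perfect_matching (delete_vertices (cell_graph quadrant) S) N} \<times>
     (if (- 1, 0) \<in> S then UNIV else {False}))"

text \<open>The cells not covered by inner edges are those whose edge leaves the quadrant. The pair
  in the last component is the middle cell with its mirror image in x = 0.\<close>

definition restrict_matching where
  "restrict_matching M =
     (quadrant - \<Union> (inner_edges M), inner_edges M, {(- 1, 0), (0, 0)} \<in> M)"

definition extend_matching where
  "extend_matching = (\<lambda>(S, N, b). klein_closure (N \<union> crossing_edge b ` S))"

lemma klein_region: "g \<in> klein \<Longrightarrow> p \<in> C \<Longrightarrow> g p \<in> C"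
  by (auto simp: klein_def mirror_x_region mirror_y_region)

lemma symmetric_matching_klein:
  assumes "M \<in> symmetric_matchings" "g \<in> klein" "e \<in> M"
  shows "g ` e \<in> M"
proof -
  have "mirror_x ` e' \<in> M" "mirror_y ` e' \<in> M" if "e' \<in> M" for e'
    using assms(1) that unfolding symmetric_matchings_def by auto
  with assms(2,3) show ?thesis
    by (auto simp: klein_def image_image[symmetric])
qed

text \<open>A neighbour outside the quadrant violates exactly one sign condition, so it is the
  mirror image in the corresponding axis. A cell on one axis only has no alternative; for the middle
  cell, uniqueness of its edge in \<open>M\<close> lets the flag decide between the two
  mirrors.\<close>

lemma crossing_edge_of_matching:
  assumes "M \<in> symmetric_matchings" "e \<in> M" "p \<in> e" "p \<in> quadrant" "\<not> e \<subseteq> quadrant"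
  shows "p \<in> axis_cells \<and> e = crossing_edge ({(- 1, 0), (0, 0)} \<in> M) p"
proof -
  have pm: "perfect_matching (cell_graph C) M"
    using assms(1) by (simp add: symmetric_matchings_def)
  obtain p' q' where "e = {p', q'}" "p' \<in> C" "q' \<in> C" "adjacent p' q'" "adjacent q' p'"
    using matching_edge[OF pm assms(2)] by (metis adjacent_def abs_minus_commute)
  with assms(3) obtain q where q: "e = {p, q}" "q \<in> C" "adjacent p q"
    by (metis insertE insert_commute singletonD)
  have "q \<notin> quadrant" using assms(4,5) q by auto
  then have cross: "fst p = - 1 \<and> q = mirror_x p \<or> snd p = 0 \<and> q = mirror_y p"
    using assms(4) q unfolding quadrant_def adjacent_def
    by (cases p; cases q) (auto simp: mirror_x_def mirror_y_def)
  have unique: "e' = e" if "e' \<in> M" "p \<in> e'" for e'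
    using matching_unique[OF pm _ that(1) assms(2) that(2) assms(3)] assms(4)
    by (simp add: quadrant_def)
  have "e = crossing_edge ({(- 1, 0), (0, 0)} \<in> M) p"
  proof (cases "p = (- 1, 0)")
    case True
    then have "{(- 1, 0), (0, 0)} \<in> M \<longleftrightarrow> e = {p, mirror_x p}"
      using unique[of "{(- 1, 0), (0, 0)}"] assms(2) by (auto simp: mirror_x_def)
    moreover have "fst p = - 1" "snd p = 0" using True by simp_all
    ultimately show ?thesis
      using cross q(1) unfolding crossing_edge_def by metis
  next
    case False
    then have "\<not> (fst p = - 1 \<and> snd p = 0)" by (simp add: prod_eq_iff)
    then show ?thesis
      using cross q(1) unfolding crossing_edge_def by metis
  qed
  with cross assms(4) show ?thesis by (auto simp: axis_cells_def)
qed

lemma restrict_matching_quarter_data: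
  assumes M: "M \<in> symmetric_matchings"
  shows "restrict_matching M \<in> quarter_data"
proof -
  define S where "S = quadrant - \<Union> (inner_edges M)"
  have pm: "perfect_matching (cell_graph C) M"
    using M by (simp add: symmetric_matchings_def)
  have S_axis: "S \<subseteq> axis_cells"
  proof
    fix p assume p: "p \<in> S"
    then have pq: "p \<in> quadrant" by (simp add: S_def)
    then have "p \<in> C" by (simp add: quadrant_def)
    then obtain e where e: "e \<in> M" "p \<in> e"
      using matching_covers[OF pm] by blast
    with p have "\<not> e \<subseteq> quadrant" by (auto simp: S_def inner_edges_def)
    then show "p \<in> axis_cells" using crossing_edge_of_matching[OF M e pq] by simp
  qed
  have "perfect_matching (delete_vertices (cell_graph quadrant) S) (inner_edges M)"
    unfolding perfect_matching_delete_cells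
  proof (intro conjI ballI)
    fix e assume e: "e \<in> inner_edges M"
    then obtain p q where "e = {p, q}" "adjacent p q"
      using matching_edge[OF pm] unfolding inner_edges_def by blast
    moreover have "e \<subseteq> quadrant - S" using e unfolding S_def inner_edges_def by blast
    ultimately show "\<exists>p\<in>quadrant - S. \<exists>q\<in>quadrant - S. e = {p, q} \<and> adjacent p q"
      by blast
  next
    fix p assume p: "p \<in> quadrant - S"
    then obtain e where e: "e \<in> inner_edges M" "p \<in> e" by (auto simp: S_def)
    have "p \<in> C" using p by (simp add: quadrant_def)
    then have "\<exists>!e. e \<in> M \<and> p \<in> e"
      using pm unfolding perfect_matching_cell_graph by blast
    with e show "\<exists>!e. e \<in> inner_edges M \<and> p \<in> e" unfolding inner_edges_def by blast
  qed
  \<comment> \<open>The flag may be true only if the middle cell is in \<open>S\<close>: the flagged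
    edge leaves the quadrant at (0, 0), and it is the only edge of \<open>M\<close> at the middle
    cell.\<close>
  moreover have "(- 1, 0) \<in> S" if b: "{(- 1, 0), (0, 0)} \<in> M"
  proof -
    have c: "(- 1, 0) \<in> C"
      using matching_edge[OF pm b] by (auto simp: doubleton_eq_iff)
    have "e = {(- 1, 0), (0, 0)}" if "e \<in> M" "(- 1, 0) \<in> e" for e
      using matching_unique[OF pm c that(1) b that(2)] by simp
    moreover have "\<not> {(- 1, 0), (0, 0)} \<subseteq> quadrant" "(- 1, 0) \<in> quadrant"
      using c by (auto simp: quadrant_def)
    ultimately show ?thesis unfolding S_def inner_edges_def by blast
  qed
  ultimately show ?thesis
    using S_axis unfolding restrict_matching_def quarter_data_def S_def by auto
qed

text \<open>\<open>K\<close> consists of the edges of \<open>M\<close> that meet the quadrant. By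
  symmetry \<open>M\<close> contains all their images, and every edge of \<open>M\<close> can be
  moved so that it meets the quadrant.\<close>

lemma extend_restrict_matching:
  assumes M: "M \<in> symmetric_matchings"
  shows "extend_matching (restrict_matching M) = M"
proof -
  define S where "S = quadrant - \<Union> (inner_edges M)"
  define b where "b \<longleftrightarrow> {(- 1, 0), (0, 0)} \<in> M"
  define K where "K = inner_edges M \<union> crossing_edge b ` S"
  have pm: "perfect_matching (cell_graph C) M"
    using M by (simp add: symmetric_matchings_def)
  have "K \<subseteq> M"
  proof
    fix e assume "e \<in> K"
    then consider "e \<in> inner_edges M" | p where "p \<in> S" "e = crossing_edge b p"
      by (auto simp: K_def)
    then show "e \<in> M"
    proof cases
      case 1
      then show ?thesis by (simp add: inner_edges_def)
    next
      case 2
      then have pq: "p \<in> quadrant" by (simp add: S_def)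
      then have "p \<in> C" by (simp add: quadrant_def)
      then obtain e' where e': "e' \<in> M" "p \<in> e'"
        using matching_covers[OF pm] by blast
      with 2 have "\<not> e' \<subseteq> quadrant" by (auto simp: S_def inner_edges_def)
      then show ?thesis
        using crossing_edge_of_matching[OF M e' pq] 2 e' by (simp add: b_def)
    qed
  qed
  then have "klein_closure K \<subseteq> M"
    using symmetric_matching_klein[OF M] klein_image_involution
    unfolding klein_closure_def by (smt (verit, best) mem_Collect_eq subset_iff)
  moreover have "M \<subseteq> klein_closure K"
  proof
    fix e assume e: "e \<in> M"
    then obtain p where p: "p \<in> e" "p \<in> C"
      using matching_edge[OF pm] by blast
    \<comment> \<open>Only one endpoint is moved into the quadrant; the image edge may still
      straddle an axis, which is the second case below.\<close>
    obtain g where g: "g \<in> klein" "fst (g p) < 0" "0 \<le> snd (g p)"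
      using klein_to_quadrant by blast
    have gp: "g p \<in> quadrant" using g p by (simp add: quadrant_def klein_region)
    have ge: "g ` e \<in> M" using symmetric_matching_klein[OF M g(1) e] .
    have "g ` e \<in> K"
    proof (cases "g ` e \<subseteq> quadrant")
      case True
      then show ?thesis using ge by (simp add: K_def inner_edges_def)
    next
      case False
      have "g p \<notin> \<Union> (inner_edges M)"
      proof
        assume "g p \<in> \<Union> (inner_edges M)"
        then obtain e' where "e' \<in> M" "e' \<subseteq> quadrant" "g p \<in> e'"
          by (auto simp: inner_edges_def)
        moreover have "g p \<in> C" "g p \<in> g ` e" using gp p by (auto simp: quadrant_def)
        ultimately show False
          using matching_unique[OF pm] ge False by metis
      qed
      then show ?thesis
        using crossing_edge_of_matching[OF M ge _ gp False] p gp
        by (auto simp: K_def S_def b_def)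
    qed
    then show "e \<in> klein_closure K" using g(1) by (auto simp: klein_closure_def)
  qed
  ultimately show ?thesis
    by (simp add: extend_matching_def restrict_matching_def K_def S_def b_def)
qed

section \<open>From quarter data back to a symmetric matching\<close>

lemma crossing_edge_not_inner: "p \<in> quadrant \<Longrightarrow> \<not> crossing_edge b p \<subseteq> quadrant"
  by (auto simp: crossing_edge_def quadrant_def mirror_x_def mirror_y_def)

lemma crossing_edge_self: "p \<in> crossing_edge b p"
  by (simp add: crossing_edge_def)

text \<open>If \<open>f\<close> brings an edge into the generating set, then \<open>f\<close>
  composed with a mirror does so for the mirrored edge. The two mirrors generate the group, and
  involutivity gives the converse.\<close>

lemma extend_klein_iff:
  assumes "g \<in> klein"
  shows "g ` e \<in> extend_matching (S, N, b) \<longleftrightarrow> e \<in> extend_matching (S, N, b)"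
proof -
  have 1: "mirror_x ` e \<in> klein_closure K" if e: "e \<in> klein_closure K" for e K
  proof -
    obtain f where "f \<in> klein" "f ` e \<in> K" using e by (auto simp: klein_closure_def)
    then have "(f \<circ> mirror_x) ` mirror_x ` e \<in> K" "f \<circ> mirror_x \<in> klein"
      by (simp_all add: klein_mirror_x image_image)
    then show ?thesis unfolding klein_closure_def by blast
  qed
  have 2: "mirror_y ` e \<in> klein_closure K" if e: "e \<in> klein_closure K" for e K
  proof -
    obtain f where "f \<in> klein" "f ` e \<in> K" using e by (auto simp: klein_closure_def)
    then have "(f \<circ> mirror_y) ` mirror_y ` e \<in> K" "f \<circ> mirror_y \<in> klein"
      by (simp_all add: klein_mirror_y image_image)
    then show ?thesis unfolding klein_closure_def by blast
  qed
  have 3: "g ` e \<in> klein_closure K" if "e \<in> klein_closure K" for e K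
    using assms 1 2 that by (auto simp: klein_def image_image[symmetric])
  show ?thesis
    using 3 klein_image_involution[OF assms] unfolding extend_matching_def by auto metis
qed

context
  fixes S N b
  assumes data: "(S, N, b) \<in> quarter_data"
begin

lemma S_axis: "S \<subseteq> axis_cells"
  and N_matching: "perfect_matching (delete_vertices (cell_graph quadrant) S) N"
  and b_middle: "b \<Longrightarrow> (- 1, 0) \<in> S"
  using data by (auto simp: quarter_data_def split: if_splits)

lemma S_quadrant: "S \<subseteq> quadrant"
  using S_axis by (auto simp: axis_cells_def)

lemma N_edge: "e \<in> N \<Longrightarrow> \<exists>p\<in>quadrant - S. \<exists>q\<in>quadrant - S. e = {p, q} \<and> adjacent p q"
  using N_matching by (simp add: perfect_matching_delete_cells)

lemma N_subset: "e \<in> N \<Longrightarrow> e \<subseteq> quadrant - S"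
  using N_edge[of e] by auto

text \<open>Near the quadrant the closure adds nothing new: a copy of an \<open>N\<close>-edge
  meeting the quadrant comes from \<open>id\<close> by freeness, and a copy of a crossing edge
  meeting it is that crossing edge itself. All later claims about the closure reduce to this
  description.\<close>

lemma extend_edge_at_quadrant:
  assumes "p \<in> quadrant" "p \<in> e"
  shows "e \<in> extend_matching (S, N, b) \<longleftrightarrow> e \<in> N \<or> p \<in> S \<and> e = crossing_edge b p"
proof
  assume "e \<in> extend_matching (S, N, b)"
  then obtain g where g: "g \<in> klein" "g ` e \<in> N \<union> crossing_edge b ` S"
    by (auto simp: extend_matching_def klein_closure_def)
  show "e \<in> N \<or> p \<in> S \<and> e = crossing_edge b p"
  proof (cases "g ` e \<in> N")
    case True
    then have "g p \<in> quadrant" using N_subset assms(2) by blast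
    then have "g = id"
      using klein_free_on_quadrant[OF g(1), of p] assms(1) by (simp add: quadrant_def)
    with True show ?thesis by simp
  next
    case False
    then obtain s where s: "s \<in> S" "g ` e = crossing_edge b s" using g(2) by blast
    then have "s \<in> quadrant" using S_quadrant by blast
    then have "p = s \<and> e = crossing_edge b s"
      using klein_crossing_edge[OF g(1) s(2) assms(2)] assms(1) by (simp add: quadrant_def)
    with s show ?thesis by blast
  qed
next
  have "id \<in> klein" by (simp add: klein_def)
  moreover assume "e \<in> N \<or> p \<in> S \<and> e = crossing_edge b p"
  then have "id ` e \<in> N \<union> crossing_edge b ` S" by (simp only: image_id id_apply) blast
  ultimately show "e \<in> extend_matching (S, N, b)"
    unfolding extend_matching_def klein_closure_def prod.case by blast
qed

lemma extend_unique_edge_quadrant: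
  assumes "p \<in> quadrant"
  shows "\<exists>!e. e \<in> extend_matching (S, N, b) \<and> p \<in> e"
proof (cases "p \<in> S")
  case True
  then have "e \<notin> N" if "p \<in> e" for e using N_subset that by blast
  then show ?thesis
    using True extend_edge_at_quadrant[OF assms] crossing_edge_self by metis
next
  case False
  then have "\<exists>!e. e \<in> N \<and> p \<in> e"
    using N_matching assms by (simp add: perfect_matching_delete_cells)
  then show ?thesis
    using False extend_edge_at_quadrant[OF assms] by metis
qed

lemma extend_edge:
  assumes "e \<in> extend_matching (S, N, b)"
  shows "\<exists>p\<in>C. \<exists>q\<in>C. e = {p, q} \<and> adjacent p q"
proof -
  obtain g where g: "g \<in> klein" "g ` e \<in> N \<union> crossing_edge b ` S"
    using assms by (auto simp: extend_matching_def klein_closure_def)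
  have "\<exists>p\<in>C. \<exists>q\<in>C. g ` e = {p, q} \<and> adjacent p q"
  proof (cases "g ` e \<in> N")
    case True
    then show ?thesis using N_edge[OF True] by (auto simp: quadrant_def)
  next
    case False
    then obtain s where s: "s \<in> S" "g ` e = crossing_edge b s" using g(2) by blast
    then have "s \<in> axis_cells" using S_axis by blast
    then have "s \<in> C" by (simp add: axis_cells_def quadrant_def)
    moreover have "crossing_edge b s = {s, mirror_x s} \<and> adjacent s (mirror_x s) \<or>
        crossing_edge b s = {s, mirror_y s} \<and> adjacent s (mirror_y s)"
      using \<open>s \<in> axis_cells\<close>
      by (auto simp: axis_cells_def quadrant_def crossing_edge_def adjacent_def mirror_x_def mirror_y_def)
    ultimately show ?thesis using s(2) mirror_x_region mirror_y_region by metis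
  qed
  then obtain p q where pq: "p \<in> C" "q \<in> C" "g ` e = {p, q}" "adjacent p q" by blast
  then have "e = {g p, g q}" using klein_image_involution[OF g(1), of e] by simp
  then show ?thesis
    using pq klein_region[OF g(1)] klein_adjacent[OF g(1)] by blast
qed

text \<open>Both existence and uniqueness are transported from the cell \<open>g p\<close> of the
  quadrant, since the extension is stable under the group.\<close>

lemma extend_unique_edge:
  assumes "p \<in> C"
  shows "\<exists>!e. e \<in> extend_matching (S, N, b) \<and> p \<in> e"
proof -
  obtain g where g: "g \<in> klein" "fst (g p) < 0" "0 \<le> snd (g p)"
    using klein_to_quadrant by blast
  have "g p \<in> quadrant" using g assms by (simp add: quadrant_def klein_region)
  then obtain e where e: "e \<in> extend_matching (S, N, b)" "g p \<in> e"
    and u: "\<And>e'. e' \<in> extend_matching (S, N, b) \<Longrightarrow> g p \<in> e' \<Longrightarrow> e' = e"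
    using extend_unique_edge_quadrant by metis
  show ?thesis
  proof (rule ex1I[of _ "g ` e"])
    show "g ` e \<in> extend_matching (S, N, b) \<and> p \<in> g ` e"
      using e extend_klein_iff[OF g(1)] klein_involution[OF g(1), of p] by (metis imageI)
  next
    fix e' assume "e' \<in> extend_matching (S, N, b) \<and> p \<in> e'"
    then have "g ` e' = e" using u extend_klein_iff[OF g(1)] by blast
    then show "e' = g ` e" using klein_image_involution[OF g(1)] by metis
  qed
qed

lemma extend_symmetric: "extend_matching (S, N, b) \<in> symmetric_matchings"
proof -
  have "(`) g ` extend_matching (S, N, b) = extend_matching (S, N, b)" if "g \<in> klein" for g
  proof (intro set_eqI iffI)
    fix e assume "e \<in> (`) g ` extend_matching (S, N, b)"
    then show "e \<in> extend_matching (S, N, b)" using extend_klein_iff[OF that] by blast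
  next
    fix e assume "e \<in> extend_matching (S, N, b)"
    then have "g ` g ` e \<in> (`) g ` extend_matching (S, N, b)"
      using extend_klein_iff[OF that] by blast
    then show "e \<in> (`) g ` extend_matching (S, N, b)"
      by (simp only: klein_image_involution[OF that])
  qed
  then show ?thesis
    using extend_edge extend_unique_edge
    by (simp add: symmetric_matchings_def perfect_matching_cell_graph klein_def)
qed

text \<open>Crossing edges are never inner, so the inner edges are exactly \<open>N\<close>; the
  cells they miss are \<open>S\<close>; and the middle cell's edge reveals \<open>b\<close>.\<close>

lemma restrict_extend_matching: "restrict_matching (extend_matching (S, N, b)) = (S, N, b)"
proof -
  have inner: "inner_edges (extend_matching (S, N, b)) = N"
  proof (intro set_eqI iffI)
    fix e assume "e \<in> inner_edges (extend_matching (S, N, b))"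
    then have e: "e \<in> extend_matching (S, N, b)" "e \<subseteq> quadrant" by (auto simp: inner_edges_def)
    then obtain p where p: "p \<in> e" using extend_edge by blast
    then have "p \<in> quadrant" using e by blast
    then show "e \<in> N"
      using e p extend_edge_at_quadrant crossing_edge_not_inner by blast
  next
    fix e assume e: "e \<in> N"
    then obtain p where "p \<in> e" "p \<in> quadrant" using N_edge by blast
    then show "e \<in> inner_edges (extend_matching (S, N, b))"
      using e extend_edge_at_quadrant N_subset by (fastforce simp: inner_edges_def)
  qed
  have "\<Union> N = quadrant - S"
    using N_subset N_matching unfolding perfect_matching_delete_cells by blast
  then have S: "quadrant - \<Union> N = S" using S_quadrant by blast
  have "{(- 1, 0), (0, 0)} \<in> extend_matching (S, N, b) \<longleftrightarrow> b"
  proof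
    assume a: "{(- 1, 0), (0, 0)} \<in> extend_matching (S, N, b)"
    then have "(- 1, 0) \<in> quadrant"
      using extend_edge[OF a] by (auto simp: quadrant_def doubleton_eq_iff)
    then have "{(- 1, 0), (0, 0)} \<in> N \<or> {(- 1, 0), (0, 0)} = crossing_edge b (- 1, 0)"
      using a extend_edge_at_quadrant by blast
    moreover have "{(- 1, 0), (0, 0)} \<notin> N"
      using N_subset by (fastforce simp: quadrant_def)
    \<comment> \<open>With \<open>b\<close> false the crossing edge would be {(-1, 0), (-1, -1)},
      which misses (0, 0).\<close>
    ultimately have "(0, 0) \<in> crossing_edge b (- 1, 0)" by blast
    then show b by (simp add: crossing_edge_def mirror_y_def split: if_splits)
  next
    assume b
    then have "(- 1, 0) \<in> S" "crossing_edge b (- 1, 0) = {(- 1, 0), (0, 0)}"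
      using b_middle by (auto simp: crossing_edge_def mirror_x_def)
    then show "{(- 1, 0), (0, 0)} \<in> extend_matching (S, N, b)"
      using extend_edge_at_quadrant[of "(- 1, 0)"] S_quadrant by auto
  qed
  with inner S show ?thesis by (simp add: restrict_matching_def)
qed

end

lemma finite_matchings: "finite {N. perfect_matching (delete_vertices (cell_graph quadrant) S) N}"
proof (rule finite_subset)
  show "{N. perfect_matching (delete_vertices (cell_graph quadrant) S) N} \<subseteq> Pow (Pow C)"
    unfolding perfect_matching_delete_cells quadrant_def by blast
  show "finite (Pow (Pow C))" using finite_region by simp
qed

theorem card_symmetric_matchings:
  "card symmetric_matchings =
     (\<Sum>S\<in>Pow axis_cells. (if (- 1, 0) \<in> S then 2 else 1) *
        num_perfect_matchings (delete_vertices (cell_graph quadrant) S))"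
proof -
  have "bij_betw restrict_matching symmetric_matchings quarter_data"
  proof (rule bij_betw_byWitness[where f' = extend_matching])
    show "\<forall>x\<in>quarter_data. restrict_matching (extend_matching x) = x"
      using restrict_extend_matching by auto
    show "extend_matching ` quarter_data \<subseteq> symmetric_matchings"
      using extend_symmetric by auto
  qed (auto simp: extend_restrict_matching restrict_matching_quarter_data)
  then have "card symmetric_matchings = card quarter_data" by (rule bij_betw_same_card)
  also have "finite axis_cells"
    using finite_region by (simp add: axis_cells_def quadrant_def)
  then have "card quarter_data =
      (\<Sum>S\<in>Pow axis_cells.
         card ({N. perfect_matching (delete_vertices (cell_graph quadrant) S) N} \<times>
           (if (- 1, 0) \<in> S then UNIV else {False})))"
    unfolding quarter_data_def using finite_matchings by (intro card_SigmaI) auto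
  also have "\<dots> = (\<Sum>S\<in>Pow axis_cells. (if (- 1, 0) \<in> S then 2 else 1) *
        num_perfect_matchings (delete_vertices (cell_graph quadrant) S))"
    by (intro sum.cong) (auto simp: card_cartesian_product num_perfect_matchings_def)
  finally show ?thesis .
qed

end

section \<open>Domino tilings as matchings of cells\<close>

definition cell :: "int \<times> int \<Rightarrow> (real \<times> real) set" where
  "cell p = unit_square (fst p) (snd p)"

text \<open>Boundary points can belong to several closed cells, a centre to only one. Centres thus
  recover a set of cells from its region and witness overlapping interiors.\<close>

definition center :: "int \<times> int \<Rightarrow> real \<times> real" where
  "center p = (of_int (fst p) + 1 / 2, of_int (snd p) + 1 / 2)"

definition region :: "(int \<times> int) set \<Rightarrow> (real \<times> real) set" where
  "region e = \<Union> (cell ` e)"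

lemma center_in_cell: "center p \<in> cell q \<longleftrightarrow> p = q"
proof
  assume "center p \<in> cell q"
  then have "real_of_int (fst q) < of_int (fst p + 1)" "real_of_int (fst p) < of_int (fst q + 1)"
    "real_of_int (snd q) < of_int (snd p + 1)" "real_of_int (snd p) < of_int (snd q + 1)"
    by (auto simp: center_def cell_def unit_square_def)
  then show "p = q"
    unfolding of_int_less_iff by (simp add: prod_eq_iff)
qed (simp add: center_def cell_def unit_square_def)

lemma inj_cell: "inj cell"
  by (metis center_in_cell injI)

lemma center_in_region: "center p \<in> region e \<longleftrightarrow> p \<in> e"
  by (auto simp: region_def center_in_cell)

lemma inj_region: "inj region"
  by (rule injI) (metis center_in_region set_eqI)

lemma Union_region: "\<Union> (region ` M) = region (\<Union> M)"
  by (auto simp: region_def)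

lemma center_in_interior:
  assumes "p \<in> e"
  shows "center p \<in> interior (region e)"
proof (rule interiorI)
  show "open ({of_int (fst p) <..< of_int (fst p) + 1} \<times>
      {of_int (snd p) <..< of_int (snd p) + (1 :: real)} :: (real \<times> real) set)"
    by (intro open_Times open_greaterThanLessThan)
  show "center p \<in> {of_int (fst p) <..< of_int (fst p) + 1} \<times>
      {of_int (snd p) <..< of_int (snd p) + 1}"
    by (simp add: center_def)
  have "{of_int (fst p) <..< of_int (fst p) + 1} \<times>
      {of_int (snd p) <..< of_int (snd p) + 1} \<subseteq> cell p"
    unfolding cell_def unit_square_def by (intro Sigma_mono) auto
  then show "{of_int (fst p) <..< of_int (fst p) + 1} \<times>
      {of_int (snd p) <..< of_int (snd p) + 1} \<subseteq> region e"
    using assms unfolding region_def by blast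
qed

section \<open>Dominoes as adjacent pairs of cells, tilings as perfect matchings\<close>

lemma region_horizontal:
  "region {(i, j), (i + 1, j)} = {of_int i .. of_int i + 2} \<times> {of_int j .. of_int j + 1}"
  unfolding region_def cell_def unit_square_def by auto

lemma region_vertical:
  "region {(i, j), (i, j + 1)} = {of_int i .. of_int i + 1} \<times> {of_int j .. of_int j + 2}"
  unfolding region_def cell_def unit_square_def by auto

lemma adjacent_cases:
  assumes "adjacent p q"
  obtains i j where "{p, q} = {(i, j), (i + 1, j)}" | i j where "{p, q} = {(i, j), (i, j + 1)}"
proof -
  obtain a b c d where pq: "p = (a, b)" "q = (c, d)" by (cases p, cases q)
  then have "c = a + 1 \<and> d = b \<or> a = c + 1 \<and> d = b \<or> c = a \<and> d = b + 1 \<or> c = a \<and> b = d + 1"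
    using assms by (auto simp: adjacent_def)
  then consider "c = a + 1" "d = b" | "a = c + 1" "d = b" | "c = a" "d = b + 1" | "c = a" "b = d + 1"
    by blast
  then show thesis
  proof cases
    case 1
    then show thesis using pq that(1)[of a b] by simp
  next
    case 2
    then show thesis using pq that(1)[of c d] by (simp add: insert_commute)
  next
    case 3
    then show thesis using pq that(2)[of a b] by simp
  next
    case 4
    then show thesis using pq that(2)[of c d] by (simp add: insert_commute)
  qed
qed

lemma domino_iff_region: "domino D \<longleftrightarrow> (\<exists>p q. adjacent p q \<and> D = region {p, q})"
proof
  assume "domino D"
  then obtain i j :: int where
    "D = region {(i, j), (i + 1, j)} \<or> D = region {(i, j), (i, j + 1)}"
    unfolding domino_def region_horizontal region_vertical by blast
  moreover have "adjacent (i, j) (i + 1, j)" "adjacent (i, j) (i, j + 1)"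
    by (simp_all add: adjacent_def)
  ultimately show "\<exists>p q. adjacent p q \<and> D = region {p, q}" by blast
next
  assume "\<exists>p q. adjacent p q \<and> D = region {p, q}"
  then obtain p q where "adjacent p q" "D = region {p, q}" by blast
  then show "domino D"
    unfolding domino_def
    by (metis adjacent_cases region_horizontal region_vertical)
qed

lemma interior_edge_cases:
  assumes "adjacent p q" "(x, y) \<in> interior (region {p, q})"
  obtains i j where "{p, q} = {(i, j), (i + 1, j)}"
      "of_int i < x" "x < of_int (i + 2)" "of_int j < y" "y < of_int (j + 1)"
    | i j where "{p, q} = {(i, j), (i, j + 1)}"
      "of_int i < x" "x < of_int (i + 1)" "of_int j < y" "y < of_int (j + 2)"
  using assms(1)
proof (cases rule: adjacent_cases)
  case (1 i j)
  then have "(x, y) \<in> {of_int i <..< of_int i + 2} \<times> {of_int j <..< of_int j + 1}"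
    using assms(2) by (simp only: region_horizontal interior_Times interior_atLeastAtMost_real)
  with 1 that(1) show thesis by simp
next
  case (2 i j)
  then have "(x, y) \<in> {of_int i <..< of_int i + 1} \<times> {of_int j <..< of_int j + 2}"
    using assms(2) by (simp only: region_vertical interior_Times interior_atLeastAtMost_real)
  with 2 that(2) show thesis by simp
qed

text \<open>Two open intervals with integer ends that share a point have left ends differing by less
  than a length, so the integer corners leave few positions. In each of them the two dominoes have a
  common cell.\<close>

lemma overlapping_edges_meet:
  assumes "adjacent p q" "adjacent p' q'"
    and "z \<in> interior (region {p, q})" "z \<in> interior (region {p', q'})"
  shows "{p, q} \<inter> {p', q'} \<noteq> {}"
proof -
  obtain x y where z: "z = (x, y)" by (cases z)
  have less: "a < b" if "real_of_int a < u" "u < real_of_int b" for a b u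
    using that of_int_less_iff[where 'a = real] by (metis less_trans)
  show ?thesis
    using assms(1) assms(3)[unfolded z]
  proof (cases rule: interior_edge_cases)
    case e: (1 i j)
    show ?thesis
      using assms(2) assms(4)[unfolded z]
    proof (cases rule: interior_edge_cases)
      case f: (1 k l)
      have "i < k + 2" "k < i + 2" "j < l + 1" "l < j + 1" using e f less by blast+
      then have "l = j" "k = i \<or> k = i + 1 \<or> i = k + 1" by auto
      then show ?thesis unfolding e(1) f(1) by auto
    next
      case f: (2 k l)
      have "i < k + 1" "k < i + 2" "j < l + 2" "l < j + 1" using e f less by blast+
      then have "k = i \<or> k = i + 1" "j = l \<or> j = l + 1" by auto
      then show ?thesis unfolding e(1) f(1) by auto
    qed
  next
    case e: (2 i j)
    show ?thesis
      using assms(2) assms(4)[unfolded z]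
    proof (cases rule: interior_edge_cases)
      case f: (1 k l)
      have "i < k + 2" "k < i + 1" "j < l + 1" "l < j + 2" using e f less by blast+
      then have "i = k \<or> i = k + 1" "l = j \<or> l = j + 1" by auto
      then show ?thesis unfolding e(1) f(1) by auto
    next
      case f: (2 k l)
      have "i < k + 1" "k < i + 1" "j < l + 2" "l < j + 2" using e f less by blast+
      then have "i = k" "l = j \<or> l = j + 1 \<or> j = l + 1" by auto
      then show ?thesis unfolding e(1) f(1) by auto
    qed
  qed
qed

lemma tiling_of_matching:
  assumes pm: "perfect_matching (cell_graph C) M"
  shows "domino_tiling (region C) (region ` M)"
  unfolding domino_tiling_def
proof (intro conjI ballI)
  fix D assume "D \<in> region ` M"
  then show "domino D" using matching_edge[OF pm] unfolding domino_iff_region by blast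
next
  have "\<Union> M = C" using matching_edge[OF pm] matching_covers[OF pm] by blast
  then show "\<Union> (region ` M) = region C" by (simp add: Union_region)
next
  show "pairwise (\<lambda>D D'. interior D \<inter> interior D' = {}) (region ` M)"
  proof (rule pairwiseI)
    fix D D' assume "D \<in> region ` M" "D' \<in> region ` M" "D \<noteq> D'"
    then obtain e e' where e: "D = region e" "D' = region e'" "e \<in> M" "e' \<in> M" "e \<noteq> e'"
      by blast
    obtain p q where pq: "e = {p, q}" "adjacent p q" "p \<in> C" "q \<in> C"
      using matching_edge[OF pm e(3)] by blast
    obtain p' q' where pq': "e' = {p', q'}" "adjacent p' q'"
      using matching_edge[OF pm e(4)] by blast
    have "e \<inter> e' = {}"
    proof (rule ccontr)
      assume "e \<inter> e' \<noteq> {}"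
      then obtain r where r: "r \<in> e" "r \<in> e'" by blast
      then have "r \<in> C" using pq by blast
      then show False using matching_unique[OF pm _ e(3,4)] r e(5) by blast
    qed
    then show "interior D \<inter> interior D' = {}"
      using overlapping_edges_meet[OF pq(2) pq'(2)] pq(1) pq'(1) e(1,2) by blast
  qed
qed

lemma matching_of_tiling:
  assumes T: "domino_tiling (region C) T"
  shows "\<exists>M. perfect_matching (cell_graph C) M \<and> T = region ` M"
proof -
  \<comment> \<open>A priori \<open>e\<close> is any set of cells; injectivity of
    \<open>region\<close> shows that it is the pair of cells of a domino.\<close>
  define M where "M = {e. region e \<in> T}"
  have dom: "\<exists>p q. adjacent p q \<and> D = region {p, q}" if "D \<in> T" for D
    using T that by (simp add: domino_tiling_def domino_iff_region)
  have T_M: "T = region ` M" using dom unfolding M_def by blast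
  then have "region (\<Union> M) = region C"
    using T by (simp add: domino_tiling_def Union_region)
  then have union: "\<Union> M = C" using inj_region by (simp add: inj_eq)
  have edge: "\<exists>p\<in>C. \<exists>q\<in>C. e = {p, q} \<and> adjacent p q" if e: "e \<in> M" for e
  proof -
    obtain p q where pq: "adjacent p q" "region e = region {p, q}"
      using dom[of "region e"] e unfolding M_def by blast
    then have "e = {p, q}" using inj_region by (simp add: inj_eq)
    then show ?thesis using pq(1) union e by blast
  qed
  have "e = e'" if "e \<in> M" "e' \<in> M" "p \<in> e" "p \<in> e'" for p e e'
  proof (rule ccontr)
    assume "e \<noteq> e'"
    then have "region e \<noteq> region e'" using inj_region by (simp add: inj_eq)
    then have "interior (region e) \<inter> interior (region e') = {}"
      using T that(1,2) unfolding domino_tiling_def pairwise_def M_def by blast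
    \<comment> \<open>The centre of the common cell \<open>p\<close> lies in both interiors.\<close>
    then show False using center_in_interior that(3,4) by blast
  qed
  then have "\<forall>p\<in>C. \<exists>!e. e \<in> M \<and> p \<in> e" using union by blast
  with edge have "perfect_matching (cell_graph C) M"
    unfolding perfect_matching_cell_graph by blast
  with T_M show ?thesis by blast
qed

section \<open>Symmetries of tilings as symmetries of matchings\<close>

lemma involution_image_eq:
  assumes "\<And>z. f (f z) = z" "\<And>z. z \<in> B \<longleftrightarrow> f z \<in> A"
  shows "f ` A = B"
proof (intro set_eqI iffI)
  fix z assume "z \<in> f ` A"
  then show "z \<in> B" using assms by auto
next
  fix z assume "z \<in> B"
  then have "f (f z) \<in> f ` A" using assms(2) by blast
  then show "z \<in> f ` A" by (simp only: assms(1))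
qed

lemma refl_t_region: "refl_t ` region e = region (mirror_x ` e)"
proof -
  have "refl_t ` cell p = cell (mirror_x p)" for p
  proof -
    have "z \<in> cell (mirror_x p) \<longleftrightarrow> refl_t z \<in> cell p" for z
      by (cases z) (auto simp: refl_t_def cell_def unit_square_def mirror_x_def)
    moreover have "refl_t (refl_t z) = z" for z by (cases z) (simp add: refl_t_def)
    ultimately show ?thesis by (intro involution_image_eq)
  qed
  then show ?thesis by (simp add: region_def image_Union image_image)
qed

lemma rot180_region: "rot180 ` region e = region (mirror_x ` mirror_y ` e)"
proof -
  have "rot180 ` cell p = cell (mirror_x (mirror_y p))" for p
  proof -
    have "z \<in> cell (mirror_x (mirror_y p)) \<longleftrightarrow> rot180 z \<in> cell p" for z
      by (cases z) (auto simp: rot180_def cell_def unit_square_def mirror_x_def mirror_y_def)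
    moreover have "rot180 (rot180 z) = z" for z by (cases z) (simp add: rot180_def)
    ultimately show ?thesis by (intro involution_image_eq)
  qed
  then show ?thesis by (simp add: region_def image_Union image_image)
qed

lemma invariant_region_image:
  assumes "\<And>e. f ` region e = region (g ` e)"
  shows "invariant_under f (region ` M) \<longleftrightarrow> (`) g ` M = M"
proof -
  have "(\<lambda>D. f ` D) ` region ` M = region ` (`) g ` M"
    by (simp add: image_image assms)
  then show ?thesis
    using inj_region by (simp add: invariant_under_def inj_image_eq_iff)
qed

lemma klein_invariant_iff:
  "invariant_under refl_t (region ` M) \<and> invariant_under rot180 (region ` M) \<longleftrightarrow>
     (`) mirror_x ` M = M \<and> (`) mirror_y ` M = M"
proof -
  have "invariant_under rot180 (region ` M) \<longleftrightarrow> (`) mirror_x ` (`) mirror_y ` M = M"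
    using invariant_region_image[of rot180 "mirror_x \<circ> mirror_y" M]
    by (simp add: rot180_region image_image)
  moreover have "invariant_under refl_t (region ` M) \<longleftrightarrow> (`) mirror_x ` M = M"
    by (rule invariant_region_image) (rule refl_t_region)
  \<comment> \<open>Given invariance under \<open>mirror_x\<close>, applying it once more to the
    rotation condition cancels it there and leaves \<open>mirror_y\<close>.\<close>
  moreover have "(`) mirror_x ` (`) mirror_x ` K = K" for K by (simp add: image_image)
  ultimately show ?thesis by metis
qed

lemma (in symmetric_region) card_symmetric_tilings:
  "card {T. domino_tiling (region C) T \<and> invariant_under refl_t T \<and> invariant_under rot180 T} =
     card symmetric_matchings"
proof -
  have "{T. domino_tiling (region C) T \<and> invariant_under refl_t T \<and> invariant_under rot180 T} =
      (`) region ` symmetric_matchings"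
  proof (intro set_eqI iffI)
    fix T
    assume "T \<in> {T. domino_tiling (region C) T \<and> invariant_under refl_t T \<and> invariant_under rot180 T}"
    then have T: "domino_tiling (region C) T" "invariant_under refl_t T" "invariant_under rot180 T"
      by auto
    obtain M where M: "perfect_matching (cell_graph C) M" "T = region ` M"
      using matching_of_tiling[OF T(1)] by blast
    then have "M \<in> symmetric_matchings"
      using T(2,3) klein_invariant_iff[of M] by (simp add: symmetric_matchings_def)
    with M show "T \<in> (`) region ` symmetric_matchings" by blast
  next
    fix T assume "T \<in> (`) region ` symmetric_matchings"
    then obtain M where "M \<in> symmetric_matchings" "T = region ` M" by blast
    then show "T \<in> {T. domino_tiling (region C) T \<and> invariant_under refl_t T \<and> invariant_under rot180 T}"
      using tiling_of_matching klein_invariant_iff[of M] by (simp add: symmetric_matchings_def)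
  qed
  moreover have "inj_on ((`) region) symmetric_matchings"
    using inj_region by (simp add: inj_on_def inj_image_eq_iff)
  ultimately show ?thesis by (simp add: card_image)
qed

section \<open>From graphs on squares to graphs on cells\<close>

lemma num_perfect_matchings_relabel:
  assumes f: "inj f"
  shows "num_perfect_matchings (f ` V, (`) f ` E) = num_perfect_matchings (V, E)"
proof -
  have eq: "perfect_matching (f ` V, (`) f ` E) ((`) f ` M) \<longleftrightarrow> perfect_matching (V, E) M" for M
  proof -
    have "(`) f ` M \<subseteq> (`) f ` E \<longleftrightarrow> M \<subseteq> E"
      using f by (simp add: inj_image_subset_iff inj_image_eq_iff inj_def)
    moreover have "(\<exists>!e. e \<in> (`) f ` M \<and> f v \<in> e) \<longleftrightarrow> (\<exists>!e. e \<in> M \<and> v \<in> e)" for v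
    proof -
      have "f ` e = f ` e' \<longleftrightarrow> e = e'" "f v \<in> f ` e \<longleftrightarrow> v \<in> e" for e e'
        using f by (simp_all add: inj_image_eq_iff inj_image_mem_iff)
      then show ?thesis by (smt (verit, ccfv_threshold) image_iff)
    qed
    ultimately show ?thesis by (simp add: perfect_matching_def)
  qed
  have "{M'. perfect_matching (f ` V, (`) f ` E) M'} = (`) ((`) f) ` {M. perfect_matching (V, E) M}"
  proof (intro set_eqI iffI)
    fix M' assume "M' \<in> {M'. perfect_matching (f ` V, (`) f ` E) M'}"
    moreover from this obtain M where "M' = (`) f ` M"
      unfolding perfect_matching_def by (auto elim: subset_imageE)
    ultimately show "M' \<in> (`) ((`) f) ` {M. perfect_matching (V, E) M}" using eq by blast
  qed (use eq in blast)
  moreover have "inj_on ((`) ((`) f)) X" for X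
    using f by (metis inj_image_eq_iff inj_onI inj_on_def)
  ultimately show ?thesis by (simp add: num_perfect_matchings_def card_image)
qed

text \<open>The right factors are nonempty, possibly single points, so equal products have equal
  factors; this excludes an empty left side as well.\<close>

lemma segment_product_eq:
  fixes a b c d :: int
  assumes "{of_int a .. of_int b :: real} \<times> {of_int c .. of_int d :: real} =
    {of_int a' .. of_int b'} \<times> {of_int c' .. of_int d'}" and "a' \<le> b'" "c' \<le> d'"
  shows "a = a' \<and> b = b' \<and> c = c' \<and> d = d'"
proof -
  have "{of_int a' .. of_int b' :: real} \<noteq> {}" "{of_int c' .. of_int d' :: real} \<noteq> {}"
    using assms(2,3) by auto
  then have "{of_int a .. of_int b :: real} = {of_int a' .. of_int b'}"
    "{of_int c .. of_int d :: real} = {of_int c' .. of_int d'}"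
    using assms(1) by (simp_all add: times_eq_iff)
  then show ?thesis using assms(2,3) by (auto simp: Icc_eq_Icc)
qed

text \<open>The intersection is [a, b] x [c, d], where b - a and d - c are 1 minus the coordinate
  distances of the cells. It is a unit segment exactly when one distance is 0 and the other
  1.\<close>

lemma share_edge_cell: "share_edge (cell p) (cell q) \<longleftrightarrow> adjacent p q"
proof -
  define a where "a = max (fst p) (fst q)"
  define b where "b = min (fst p) (fst q) + 1"
  define c where "c = max (snd p) (snd q)"
  define d where "d = min (snd p) (snd q) + 1"
  have "cell p \<inter> cell q = {of_int a .. of_int b} \<times> {of_int c .. of_int d}"
    unfolding cell_def unit_square_def a_def b_def c_def d_def
    by (auto simp: max_def min_def)
  then have "share_edge (cell p) (cell q) \<longleftrightarrow> (\<exists>i j.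
      {of_int a .. of_int b :: real} \<times> {of_int c .. of_int d :: real} =
        {of_int i .. of_int i} \<times> {of_int j .. of_int (j + 1)} \<or>
      {of_int a .. of_int b :: real} \<times> {of_int c .. of_int d :: real} =
        {of_int i .. of_int (i + 1)} \<times> {of_int j .. of_int j})"
    by (simp add: share_edge_def)
  also have "\<dots> \<longleftrightarrow> a = b \<and> d = c + 1 \<or> b = a + 1 \<and> c = d" (is "?L \<longleftrightarrow> ?R")
  proof
    assume ?L
    then obtain i j where
      "{of_int a .. of_int b :: real} \<times> {of_int c .. of_int d :: real} =
        {of_int i .. of_int i} \<times> {of_int j .. of_int (j + 1)} \<or>
      {of_int a .. of_int b :: real} \<times> {of_int c .. of_int d :: real} =
        {of_int i .. of_int (i + 1)} \<times> {of_int j .. of_int j}"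
      by blast
    then show ?R
      using segment_product_eq[of a b c d i i j "j + 1"] segment_product_eq[of a b c d i "i + 1" j j]
      by linarith
  next
    assume ?R
    then show ?L by blast
  qed
  also have "\<dots> \<longleftrightarrow> adjacent p q"
    unfolding a_def b_def c_def d_def adjacent_def by (auto simp: max_def min_def)
  finally show ?thesis .
qed

section \<open>The Aztec diamond\<close>

text \<open>max (-i) (i+1) is the largest \<bar>x\<bar> on [i, i+1], so the bound concerns the
  corner of the cell farthest from the origin.\<close>

definition ad_cells :: "nat \<Rightarrow> (int \<times> int) set" where
  "ad_cells n = {(i, j). max (- i) (i + 1) + max (- j) (j + 1) \<le> int n + 1}"

lemma cell_subset_diamond:
  "cell (i, j) \<subseteq> {(x, y). \<bar>x\<bar> + \<bar>y\<bar> \<le> real n + 1} \<longleftrightarrow> (i, j) \<in> ad_cells n"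
proof
  assume sub: "cell (i, j) \<subseteq> {(x, y). \<bar>x\<bar> + \<bar>y\<bar> \<le> real n + 1}"
  have corner: "\<bar>k\<bar> + \<bar>l\<bar> \<le> int n + 1" if "k \<in> {i, i + 1}" "l \<in> {j, j + 1}" for k l
  proof -
    have "(of_int k, of_int l) \<in> cell (i, j)" using that by (auto simp: cell_def unit_square_def)
    then have "\<bar>real_of_int k\<bar> + \<bar>real_of_int l\<bar> \<le> real n + 1" using sub by blast
    then have "real_of_int (\<bar>k\<bar> + \<bar>l\<bar>) \<le> of_int (int n + 1)" by simp
    then show ?thesis by (simp only: of_int_le_iff)
  qed
  from corner[of i j] corner[of i "j + 1"] corner[of "i + 1" j] corner[of "i + 1" "j + 1"]
  show "(i, j) \<in> ad_cells n" by (simp add: ad_cells_def) arith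
next
  assume "(i, j) \<in> ad_cells n"
  then have "real_of_int (max (- i) (i + 1) + max (- j) (j + 1)) \<le> of_int (int n + 1)"
    unfolding of_int_le_iff by (simp add: ad_cells_def)
  then have le: "max (- real_of_int i) (of_int i + 1) + max (- real_of_int j) (of_int j + 1) \<le> real n + 1"
    by (simp add: of_int_max)
  show "cell (i, j) \<subseteq> {(x, y). \<bar>x\<bar> + \<bar>y\<bar> \<le> real n + 1}"
  proof clarify
    fix x y assume "(x, y) \<in> cell (i, j)"
    then have "\<bar>x\<bar> \<le> max (- real_of_int i) (of_int i + 1)" "\<bar>y\<bar> \<le> max (- real_of_int j) (of_int j + 1)"
      by (auto simp: cell_def unit_square_def)
    with le show "\<bar>x\<bar> + \<bar>y\<bar> \<le> real n + 1" by linarith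
  qed
qed

lemma AD_squares_cells: "AD_squares n = cell ` ad_cells n"
proof (intro set_eqI iffI)
  fix A assume "A \<in> AD_squares n"
  then obtain i j where "A = cell (i, j)" "A \<subseteq> {(x, y). \<bar>x\<bar> + \<bar>y\<bar> \<le> real n + 1}"
    unfolding AD_squares_def cell_def by auto
  then show "A \<in> cell ` ad_cells n" using cell_subset_diamond by blast
next
  fix A assume "A \<in> cell ` ad_cells n"
  then obtain i j where "A = cell (i, j)" "(i, j) \<in> ad_cells n" by auto
  then have "A = unit_square i j" "A \<subseteq> {(x, y). \<bar>x\<bar> + \<bar>y\<bar> \<le> real n + 1}"
    using cell_subset_diamond by (simp_all add: cell_def)
  then show "A \<in> AD_squares n" unfolding AD_squares_def by blast
qed

lemma AD_region: "AD n = region (ad_cells n)"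
  by (simp add: AD_def AD_squares_cells region_def)

text \<open>The map sending i to -1-i exchanges -i and i+1, so it preserves the maximum in
  \<open>ad_cells\<close>.\<close>

interpretation aztec: symmetric_region "ad_cells n" for n
proof
  have "ad_cells n \<subseteq> {- int n - 1 .. int n + 1} \<times> {- int n - 1 .. int n + 1}"
    by (auto simp: ad_cells_def)
  then show "finite (ad_cells n)" by (rule finite_subset) simp
qed (auto simp: ad_cells_def mirror_x_def mirror_y_def)

lemma Q_vertices_cells: "Q_vertices n = cell ` aztec.quadrant n"
proof -
  have "cell p \<subseteq> {(x, y). x \<le> 0 \<and> y \<ge> 0} \<longleftrightarrow> fst p < 0 \<and> 0 \<le> snd p" for p
  proof
    assume sub: "cell p \<subseteq> {(x, y). x \<le> 0 \<and> y \<ge> 0}"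
    have "(of_int (fst p + 1), of_int (snd p)) \<in> cell p" by (simp add: cell_def unit_square_def)
    then have "real_of_int (fst p + 1) \<le> 0 \<and> 0 \<le> real_of_int (snd p)" using sub by blast
    then show "fst p < 0 \<and> 0 \<le> snd p"
      unfolding of_int_le_0_iff of_int_0_le_iff by simp
  next
    assume "fst p < 0 \<and> 0 \<le> snd p"
    then have "real_of_int (fst p + 1) \<le> 0 \<and> 0 \<le> real_of_int (snd p)"
      unfolding of_int_le_0_iff of_int_0_le_iff by simp
    then show "cell p \<subseteq> {(x, y). x \<le> 0 \<and> y \<ge> 0}" by (auto simp: cell_def unit_square_def)
  qed
  then show ?thesis
    unfolding Q_vertices_def AD_squares_cells aztec.quadrant_def by blast
qed

lemma Q_relabel:
  "Q n = (cell ` fst (cell_graph (aztec.quadrant n)), (`) cell ` snd (cell_graph (aztec.quadrant n)))"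
proof -
  have "{{A, B} | A B. A \<in> Q_vertices n \<and> B \<in> Q_vertices n \<and> share_edge A B} =
      {{cell p, cell q} | p q. p \<in> aztec.quadrant n \<and> q \<in> aztec.quadrant n \<and> adjacent p q}"
    unfolding Q_vertices_cells share_edge_cell[symmetric] by blast
  also have "\<dots> = (`) cell ` {{p, q} | p q. p \<in> aztec.quadrant n \<and> q \<in> aztec.quadrant n \<and> adjacent p q}"
    (is "?L = ?R")
  proof (intro set_eqI iffI)
    fix e assume "e \<in> ?L"
    then obtain p q where "e = cell ` {p, q}" "p \<in> aztec.quadrant n" "q \<in> aztec.quadrant n"
      "adjacent p q" unfolding image_insert image_empty by blast
    then show "e \<in> ?R" by blast
  next
    fix e assume "e \<in> ?R"
    then obtain p q where "e = cell ` {p, q}" "p \<in> aztec.quadrant n" "q \<in> aztec.quadrant n"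
      "adjacent p q" by blast
    then show "e \<in> ?L" unfolding image_insert image_empty by blast
  qed
  finally show ?thesis by (simp add: Q_def Q_vertices_cells cell_graph_def)
qed

lemma delete_vertices_relabel:
  assumes "inj f"
  shows "delete_vertices (f ` V, (`) f ` E) (f ` S) =
    (f ` fst (delete_vertices (V, E) S), (`) f ` snd (delete_vertices (V, E) S))"
proof -
  have "f ` e \<inter> f ` S = {} \<longleftrightarrow> e \<inter> S = {}" for e
    using assms by (simp flip: image_Int)
  then show ?thesis
    using assms by (auto simp: delete_vertices_def image_set_diff)
qed

lemma num_perfect_matchings_Q:
  "num_perfect_matchings (delete_vertices (Q n) (cell ` S)) =
    num_perfect_matchings (delete_vertices (cell_graph (aztec.quadrant n)) S)"
  unfolding Q_relabel delete_vertices_relabel[OF inj_cell] num_perfect_matchings_relabel[OF inj_cell]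
  by simp

text \<open>For (-1, j) with j \<ge> 0 the diamond condition reads 1 + (j+1) \<le> n+1, and for (i,
  0) with i < 0 it reads -i + 1 \<le> n+1; these are the stated ranges.\<close>

lemma distinguished_cells: "distinguished n = cell ` aztec.axis_cells n"
proof -
  have "aztec.axis_cells n =
      {(- 1, j) | j. 0 \<le> j \<and> j \<le> int n - 1} \<union> {(i, 0) | i. - int n \<le> i \<and> i \<le> - 1}"
    unfolding aztec.axis_cells_def aztec.quadrant_def by (auto simp: ad_cells_def)
  then have "cell ` aztec.axis_cells n =
      {cell (- 1, j) | j. 0 \<le> j \<and> j \<le> int n - 1} \<union> {cell (i, 0) | i. - int n \<le> i \<and> i \<le> - 1}"
    by (simp only:) blast
  then show ?thesis by (simp add: distinguished_def cell_def)
qed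

theorem theorem7:
  fixes n :: nat
  assumes "n \<ge> 1"
  shows "(\<Sum>S\<in>Pow (distinguished n).
            weight S * num_perfect_matchings (delete_vertices (Q n) S)) =
         card {T. domino_tiling (AD n) T \<and> invariant_under refl_t T \<and> invariant_under rot180 T}"
proof -
  \<comment> \<open>The sum is reindexed along the injection \<open>cell\<close>, which sends (-1,
    0) to \<open>middle\<close> and so matches the weights.\<close>
  have "Pow (distinguished n) = (`) cell ` Pow (aztec.axis_cells n)"
    by (simp add: distinguished_cells image_Pow_surj)
  moreover have "inj_on ((`) cell) (Pow (aztec.axis_cells n))"
    using inj_cell by (simp add: inj_on_def inj_image_eq_iff)
  moreover have "weight (cell ` S) = (if (- 1, 0) \<in> S then 2 else 1)" for S
    using inj_image_mem_iff[OF inj_cell, of "(- 1, 0)" S]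
    by (simp add: weight_def middle_def cell_def)
  ultimately have "(\<Sum>S\<in>Pow (distinguished n).
        weight S * num_perfect_matchings (delete_vertices (Q n) S)) =
      (\<Sum>S\<in>Pow (aztec.axis_cells n). (if (- 1, 0) \<in> S then 2 else 1) *
        num_perfect_matchings (delete_vertices (cell_graph (aztec.quadrant n)) S))"
    by (simp add: sum.reindex num_perfect_matchings_Q)
  then show ?thesis
    unfolding AD_region aztec.card_symmetric_tilings aztec.card_symmetric_matchings .
qed

end
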